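(* Let $n,s_1,s_2$ be integers such that $0\le s_1<s_2<n$, and let $a,b$ be non-zero complex numbers such that $a^{\,n\backslash(s_2-s_1)}-(-b)^{\,n\backslash(s_2-s_1)}\ne 0$. Then $$\left(aP_n^{s_1}+bP_n^{s_2}\right)^{-1}=\frac{1}{a^{\,n\backslash(s_2-s_1)}-(-b)^{\,n\backslash(s_2-s_1)}}\sum_{i=0}^{n-1}\rho_{n,s_2-s_1}(i+s_1)\,P_n^{i}.$$
   Context: Matrix indices run over $[n]:=\{0,1,\dots,n-1\}$. $P_n$ is the $n\times n$ permutation matrix with $(P_n)_{i,j}=1$ if $j\equiv i+1\pmod n$ and $0$ otherwise; $P_n^0=I_n$. $(n,s)$ denotes the greatest common divisor and $n\backslash s:=n/(n,s)$. For integers $0<s<n$ and $i\in[n]$, there are unique $h\in[(n,s)]$ and $t\in[n\backslash s]$ with $i\equiv ts+h\pmod n$; put $\operatorname{cycle}_{n,s}(i):=h$ and $\operatorname{pos}_{n,s}(i):=t$. For an arbitrary integer argument, these functions are evaluated at its residue modulo $n$ in $[n]$. With $\delta$ the Kronecker delta, $$\rho_{n,s}(i):=(-1)^{\operatorname{pos}_{n,s}(i)}\,\delta_{0,\operatorname{cycle}_{n,s}(i)}\,b^{\operatorname{pos}_{n,s}(i)}\,a^{(n\backslash s)-1-\operatorname{pos}_{n,s}(i)}.$$ *)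

theory Defs
  imports "Jordan_Normal_Form.Matrix" "HOL-Number_Theory.Cong"
begin

definition perm_mat :: "nat \<Rightarrow> complex mat" where
  "perm_mat n = mat n n (\<lambda>(i, j). if [j = i + 1] (mod n) then 1 else 0)"

definition reduced :: "nat \<Rightarrow> nat \<Rightarrow> nat" where
  "reduced n s = n div gcd n s"

(* The congruence only sees the residue of i modulo n, so an arbitrary integer argument
   is automatically evaluated at its residue in {0..<n}. *)
definition cycle_pos :: "nat \<Rightarrow> nat \<Rightarrow> int \<Rightarrow> nat \<times> nat" where
  "cycle_pos n s i = (THE (h, t). h < gcd n s \<and> t < reduced n s \<and> [i = int (t * s + h)] (mod int n))"

definition cycle :: "nat \<Rightarrow> nat \<Rightarrow> int \<Rightarrow> nat" where
  "cycle n s i = fst (cycle_pos n s i)"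

definition pos :: "nat \<Rightarrow> nat \<Rightarrow> int \<Rightarrow> nat" where
  "pos n s i = snd (cycle_pos n s i)"

definition rho :: "complex \<Rightarrow> complex \<Rightarrow> nat \<Rightarrow> nat \<Rightarrow> int \<Rightarrow> complex" where
  "rho a b n s i =
     (-1) ^ pos n s i * (if cycle n s i = 0 then 1 else 0)
       * b ^ pos n s i * a ^ (reduced n s - 1 - pos n s i)"

lemma cycle_pos_ex1:
  assumes "0 < s" "s < n"
  shows "\<exists>!(h, t). h < gcd n s \<and> t < reduced n s \<and> [i = int (t * s + h)] (mod int n)"
proof -
  define g where "g = gcd n s"
  define m where "m = reduced n s"
  have g: "g > 0" and n: "n = m * g"
    using assms by (auto simp: g_def m_def reduced_def)
  have m: "m > 0" using n assms by (cases m) auto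
  obtain r where s: "s = r * g" using g_def by (metis dvd_div_mult_self gcd_dvd2)
  have cop: "coprime m r"
  proof -
    have "gcd m r * g = g"
      using n s by (metis g_def gcd_mult_distrib_nat mult.commute)
    then show ?thesis using g by (simp add: coprime_iff_gcd_eq_1)
  qed
  have "coprime (int r) (int m)" using cop by (simp add: coprime_commute)
  then obtain x where x: "[int r * x = 1] (mod int m)"
    using cong_solve_coprime_int by blast
  define h where "h = nat (i mod int g)"
  define k where "k = i div int g"
  define t where "t = nat ((x * k) mod int m)"
  have h: "int h = i mod int g" "h < g"
    using g by (auto simp: h_def nat_less_iff)
  have t: "int t = (x * k) mod int m" "t < m"
    using m by (auto simp: t_def nat_less_iff)
  have "[int t * int r = (x * k) * int r] (mod int m)"
    unfolding t(1) by (intro cong_mult cong_refl) (simp add: cong_def)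
  also have "[(x * k) * int r = k] (mod int m)"
    using cong_mult[OF x cong_refl[of k]] by (simp add: ac_simps)
  finally have "[(int t * int r) * int g = k * int g] (mod int n)"
    unfolding n of_nat_mult cong_iff_dvd_diff
    by (metis dvd_refl left_diff_distrib mult_dvd_mono)
  then have "[int t * int s + int h = k * int g + int h] (mod int n)"
    by (simp add: s cong_add_rcancel mult.assoc)
  moreover have "k * int g + int h = i" by (simp add: h(1) k_def)
  ultimately have ex: "[i = int (t * s + h)] (mod int n)"
    by (simp add: cong_sym)
  have uniq: "h' = h'' \<and> t' = t''"
    if A: "h' < g" "t' < m" "[i = int (t' * s + h')] (mod int n)"
      and B: "h'' < g" "t'' < m" "[i = int (t'' * s + h'')] (mod int n)"
    for h' h'' t' t''
  proof -
    have c: "[t' * s + h' = t'' * s + h''] (mod n)"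
      using A(3) B(3) by (meson cong_int_iff cong_sym cong_trans)
    then have "[t' * s + h' = t'' * s + h''] (mod g)"
      by (rule cong_dvd_modulus_nat) (simp add: n)
    then have "h' = h''" using A(1) B(1) by (simp add: cong_def s flip: mult.assoc)
    moreover from this have "[t' * s = t'' * s] (mod n)"
      using c by (simp add: cong_add_rcancel_nat)
    then have "[t' * r = t'' * r] (mod m)"
      using g by (simp add: cong_def n s flip: mult.assoc)
    then have "[t' = t''] (mod m)"
      using cop by (simp add: cong_mult_rcancel_nat coprime_commute)
    then have "t' = t''" using A(2) B(2) by (simp add: cong_def)
    ultimately show ?thesis by simp
  qed
  show ?thesis
    unfolding g_def[symmetric] m_def[symmetric]
    by (rule ex1I[of _ "(h, t)"]) (use h t ex uniq in auto)
qed

end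

theory Submission
  imports Defs "Jordan_Normal_Form.Determinant"
begin

text \<open>Left multiplication by $P_n^k$ shifts the symbol of a circulant matrix by $k$, so the
  product of $aP_n^{s_1}+bP_n^{s_2}$ with the sum is the circulant matrix with symbol
  $x \mapsto a\rho(x)+b\rho(x-s)$, where $s = s_2-s_1$. Subtracting $s$ lowers the position by one
  within a cycle, so the two terms cancel except where the position wraps around, i.e. at
  $x \equiv 0$, where they add up to $a^m-(-b)^m$ with $m = n\backslash s$.\<close>

text \<open>The symbol takes integer arguments so that j - i does not truncate. Periodicity modulo n
  is not built in; the lemmas that shift or sum a symbol assume it.\<close>

definition circ :: "nat \<Rightarrow> (int \<Rightarrow> 'a) \<Rightarrow> 'a mat" where
  "circ n f = mat n n (\<lambda>(i, j). f (int j - int i))"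

lemma circ_carrier [simp]: "circ n f \<in> carrier_mat n n"
  by (simp add: circ_def)

lemma perm_mat_carrier [simp]: "perm_mat n \<in> carrier_mat n n"
  by (simp add: perm_mat_def)

lemma perm_mat_pow_carrier [simp]: "perm_mat n ^\<^sub>m k \<in> carrier_mat n n"
  by (simp add: pow_carrier_mat)

text \<open>Row i of \<open>perm_mat n\<close> has its only 1 in column (i + 1) mod n, so the
  product has that row of \<open>circ n f\<close> as its row i. Periodicity absorbs the wrap-around
  at i = n - 1.\<close>

lemma perm_mat_mult_circ:
  assumes per: "\<And>x y. [x = y] (mod int n) \<Longrightarrow> f x = f y"
  shows "perm_mat n * circ n f = circ n (\<lambda>x. f (x - 1))"
proof (rule eq_matI)
  fix i j assume "i < dim_row (circ n (\<lambda>x. f (x - 1)))" "j < dim_col (circ n (\<lambda>x. f (x - 1)))"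
  then have ij: "i < n" "j < n" by (auto simp: circ_def)
  define l where "l = (i + 1) mod n"
  have l: "l < n" using ij by (simp add: l_def)
  have "(perm_mat n * circ n f) $$ (i, j)
      = (\<Sum>k\<in>{0..<n}. (if [k = i + 1] (mod n) then 1 else 0) * f (int j - int k))"
    using ij by (simp add: perm_mat_def circ_def scalar_prod_def)
  also have "\<dots> = (\<Sum>k\<in>{0..<n}. if k = l then f (int j - int k) else 0)"
    by (rule sum.cong) (auto simp: cong_def l_def)
  also have "\<dots> = f (int j - int l)"
    using l by simp
  also have "\<dots> = f (int j - int i - 1)"
  proof (rule per)
    have "[int l = int (i + 1)] (mod int n)"
      unfolding cong_int_iff by (simp add: l_def cong_def)
    then have "[int j - int l = int j - int (i + 1)] (mod int n)"
      by (rule cong_diff[OF cong_refl])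
    then show "[int j - int l = int j - int i - 1] (mod int n)"
      by (simp add: algebra_simps)
  qed
  finally show "(perm_mat n * circ n f) $$ (i, j) = circ n (\<lambda>x. f (x - 1)) $$ (i, j)"
    using ij by (simp add: circ_def)
qed (auto simp: circ_def perm_mat_def)

lemma perm_mat_pow_mult_circ:
  assumes "\<And>x y. [x = y] (mod int n) \<Longrightarrow> f x = f y"
  shows "perm_mat n ^\<^sub>m k * circ n f = circ n (\<lambda>x. f (x - int k))"
  using assms
proof (induction k arbitrary: f)
  case 0
  then show ?case by (simp add: perm_mat_def circ_def)
next
  case (Suc k)
  \<comment> \<open>The innermost factor acts first, so the induction hypothesis is applied to a
    shifted symbol; hence the generalisation over \<open>f\<close>.\<close>
  have "perm_mat n ^\<^sub>m Suc k * circ n f = perm_mat n ^\<^sub>m k * (perm_mat n * circ n f)"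
    by (simp add: assoc_mult_mat[of _ n n _ n _ n])
  also have "\<dots> = perm_mat n ^\<^sub>m k * circ n (\<lambda>x. f (x - 1))"
    by (subst perm_mat_mult_circ) (use Suc.prems in auto)
  also have "\<dots> = circ n (\<lambda>x. f (x - int k - 1))"
    by (rule Suc.IH) (auto intro!: Suc.prems cong_diff)
  finally show ?case by (simp add: algebra_simps)
qed

lemma one_mat_eq_circ: "1\<^sub>m n = circ n (\<lambda>x. if [x = 0] (mod int n) then 1 else 0)"
proof (rule eq_matI)
  fix i j assume "i < dim_row (circ n (\<lambda>x. if [x = 0] (mod int n) then 1 else 0))"
    and "j < dim_col (circ n (\<lambda>x. if [x = 0] (mod int n) then 1 else 0))"
  then have ij: "i < n" "j < n" by (auto simp: circ_def)
  have "[int j - int i = 0] (mod int n) \<longleftrightarrow> [j = i] (mod n)"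
    by (simp add: cong_diff_iff_cong_0 flip: cong_int_iff)
  also have "\<dots> \<longleftrightarrow> i = j" using ij by (auto simp: cong_def)
  finally show "1\<^sub>m n $$ (i, j) = circ n (\<lambda>x. if [x = 0] (mod int n) then 1 else 0) $$ (i, j)"
    using ij by (simp add: circ_def)
qed (auto simp: circ_def)

text \<open>Shifting the symbol of the identity by k gives the symbol of the k-th power.\<close>

lemma perm_mat_pow_eq_circ:
  "perm_mat n ^\<^sub>m k = circ n (\<lambda>x. if [x = int k] (mod int n) then 1 else 0)"
proof -
  have "perm_mat n ^\<^sub>m k = perm_mat n ^\<^sub>m k * 1\<^sub>m n"
    by (simp add: right_mult_one_mat[of _ n n])
  also have "\<dots> = circ n (\<lambda>x. if [x - int k = 0] (mod int n) then 1 else 0)"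
    unfolding one_mat_eq_circ
    by (subst perm_mat_pow_mult_circ) (auto intro: cong_trans cong_sym)
  finally show ?thesis by (simp add: cong_diff_iff_cong_0)
qed

lemma finsum_mat_carrier:
  assumes "\<And>k. k \<in> X \<Longrightarrow> F k \<in> carrier_mat n m"
  shows "(\<Oplus>\<^bsub>module_mat TYPE('a :: comm_ring_1) n m\<^esub> k\<in>X. F k) \<in> carrier_mat n m"
proof -
  interpret abelian_group "module_mat TYPE('a) n m" by (rule abelian_group_mat)
  show ?thesis
    using finsum_closed[of F X] assms by (auto simp: module_mat_simps)
qed

text \<open>Reduces sums in the structure \<open>module_mat\<close>, which fixes the dimensions, to
  ordinary sums of entries. The sum over \<open>X\<close> has to be known to lie in the carrier
  before \<open>+\<close> can be read entrywise.\<close>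

lemma index_finsum_mat:
  assumes "finite X" "\<And>k. k \<in> X \<Longrightarrow> F k \<in> carrier_mat n m" "i < n" "j < m"
  shows "(\<Oplus>\<^bsub>module_mat TYPE('a :: comm_ring_1) n m\<^esub> k\<in>X. F k) $$ (i, j) = (\<Sum>k\<in>X. F k $$ (i, j))"
proof -
  interpret abelian_group "module_mat TYPE('a) n m" by (rule abelian_group_mat)
  show ?thesis
    using assms(1,2)
  proof (induction X rule: finite_induct)
    case empty
    then show ?case using assms(3,4) finsum_empty by (simp add: module_mat_simps)
  next
    case (insert x X)
    have "(\<Oplus>\<^bsub>module_mat TYPE('a) n m\<^esub> k\<in>insert x X. F k)
        = F x + (\<Oplus>\<^bsub>module_mat TYPE('a) n m\<^esub> k\<in>X. F k)"
      using insert by (subst finsum_insert) (auto simp: module_mat_simps)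
    moreover have "(\<Oplus>\<^bsub>module_mat TYPE('a) n m\<^esub> k\<in>X. F k) \<in> carrier_mat n m"
      by (rule finsum_mat_carrier) (use insert in auto)
    ultimately show ?case using insert assms(3,4) by auto
  qed
qed

text \<open>The powers with exponents below n have disjoint supports that cover all entries, so each
  entry of the sum picks out one coefficient.\<close>

lemma finsum_perm_mat_pow:
  assumes per: "\<And>x y. [x = y] (mod int n) \<Longrightarrow> f x = f y"
  shows "(\<Oplus>\<^bsub>module_mat TYPE(complex) n n\<^esub> i\<in>{0..<n}. f (int i) \<cdot>\<^sub>m (perm_mat n ^\<^sub>m i)) = circ n f"
    (is "?S = _")
proof (rule eq_matI)
  have S: "?S \<in> carrier_mat n n"
    by (rule finsum_mat_carrier) auto
  show "dim_row ?S = dim_row (circ n f)" "dim_col ?S = dim_col (circ n f)"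
    using S by (auto simp: circ_def)
  fix i j assume "i < dim_row (circ n f)" "j < dim_col (circ n f)"
  then have ij: "i < n" "j < n" by (auto simp: circ_def)
  \<comment> \<open>The only exponent below n whose power has a 1 at (i, j).\<close>
  define l where "l = nat ((int j - int i) mod int n)"
  have l: "int l = (int j - int i) mod int n" "l < n"
    using ij by (auto simp: l_def nat_less_iff)
  have "?S $$ (i, j) = (\<Sum>k\<in>{0..<n}. (f (int k) \<cdot>\<^sub>m (perm_mat n ^\<^sub>m k)) $$ (i, j))"
    by (rule index_finsum_mat) (use ij in auto)
  also have "\<dots> = (\<Sum>k\<in>{0..<n}. if k = l then f (int k) else 0)"
  proof (rule sum.cong[OF refl])
    fix k assume "k \<in> {0..<n}"
    then have "[int j - int i = int k] (mod int n) \<longleftrightarrow> k = l"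
      using l(1) by (auto simp: cong_def)
    then show "(f (int k) \<cdot>\<^sub>m (perm_mat n ^\<^sub>m k)) $$ (i, j) = (if k = l then f (int k) else 0)"
      using ij by (simp add: perm_mat_pow_eq_circ circ_def)
  qed
  also have "\<dots> = f (int l)" using l by simp
  also have "\<dots> = f (int j - int i)"
    by (rule per) (simp add: l cong_def)
  finally show "?S $$ (i, j) = circ n f $$ (i, j)"
    using ij by (simp add: circ_def)
qed

lemma cycle_pos_cong:
  "[x = y] (mod int n) \<Longrightarrow> cycle_pos n s x = cycle_pos n s y"
  unfolding cycle_pos_def by (simp add: cong_def)

lemma rho_cong: "[x = y] (mod int n) \<Longrightarrow> rho a b n s x = rho a b n s y"
  by (simp add: rho_def cycle_def pos_def cycle_pos_cong[of x y])

text \<open>Evaluates the definite description: by uniqueness, exhibiting one admissible pair is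
  enough.\<close>

lemma cycle_pos_eqI:
  assumes "0 < s" "s < n" "h < gcd n s" "t < reduced n s" "[i = int (t * s + h)] (mod int n)"
  shows "cycle_pos n s i = (h, t)"
  unfolding cycle_pos_def
  by (rule the1_equality[OF cycle_pos_ex1[OF assms(1,2)]]) (use assms in auto)

lemma cycle_posE:
  assumes "0 < s" "s < n"
  obtains h t where "h < gcd n s" "t < reduced n s" "[i = int (t * s + h)] (mod int n)"
    "cycle_pos n s i = (h, t)"
  using cycle_pos_ex1[OF assms] cycle_pos_eqI[OF assms] by blast

text \<open>Since x and x - s lie in the same cycle, the Kronecker factor kills both terms outside
  cycle 0; inside it, the position t of x separates cancellation from wrap-around.\<close>

lemma rho_recurrence:
  assumes s: "0 < s" "s < n"
  shows "a * rho a b n s x + b * rho a b n s (x - int s) =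
    (if [x = 0] (mod int n) then a ^ reduced n s - (- b) ^ reduced n s else 0)"
proof -
  define m where "m = reduced n s"
  obtain h t where ht: "h < gcd n s" "t < m" "[x = int (t * s + h)] (mod int n)"
    and cp: "cycle_pos n s x = (h, t)"
    using cycle_posE[OF s] m_def by metis
  have zero: "[x = 0] (mod int n) \<longleftrightarrow> h = 0 \<and> t = 0"
  proof
    assume "[x = 0] (mod int n)"
    then have "cycle_pos n s x = (0, 0)"
      using ht by (intro cycle_pos_eqI s) (auto simp: m_def)
    then show "h = 0 \<and> t = 0" using cp by simp
  qed (use ht in auto)
  have shift: "[x - int s = int (t * s + h) - int s] (mod int n)"
    by (intro cong_diff ht cong_refl)
  show ?thesis
  proof (cases t)
    case 0
    \<comment> \<open>m * s is the least common multiple of n and s, so the predecessor of position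
      0 is position m - 1 of the same cycle.\<close>
    have "n dvd m * s"
      unfolding m_def reduced_def
      by (metis div_mult_swap dvd_mult_div_cancel dvd_triv_left gcd_dvd1 gcd_dvd2 mult.commute mult.left_commute dvd_div_mult)
    then have "[int (m * s) = 0] (mod int n)"
      by (simp add: cong_0_iff flip: of_nat_mult)
    moreover have "int ((m - 1) * s + h) = int (m * s) + (int h - int s)"
      using ht(2) by (cases m) (auto simp: algebra_simps)
    ultimately have "[int ((m - 1) * s + h) = 0 + (int h - int s)] (mod int n)"
      by (metis cong_add cong_refl)
    then have "[x - int s = int ((m - 1) * s + h)] (mod int n)"
      using shift 0 by (simp add: cong_def)
    then have "cycle_pos n s (x - int s) = (h, m - 1)"
      using ht by (intro cycle_pos_eqI s) (auto simp: m_def)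
    \<comment> \<open>The contributions of the two ends of the cycle: position 0 has no factor b,
      and position m - 1 no factor a.\<close>
    moreover have "a * a ^ (m - 1) = a ^ m" "b * ((-1) ^ (m - 1) * b ^ (m - 1)) = - ((- b) ^ m)"
      using ht(2) by (cases m; simp add: power_minus[of b])+
    ultimately show ?thesis
      using cp 0 zero by (simp add: rho_def cycle_def pos_def flip: m_def)
  next
    \<comment> \<open>Going from position t to u = t - 1 flips the sign and trades a factor b for a
      factor a, so both terms are b^t a^(m - t) up to opposite signs.\<close>
    case (Suc u)
    have "[x - int s = int (u * s + h)] (mod int n)"
      using shift Suc by (simp add: algebra_simps)
    then have "cycle_pos n s (x - int s) = (h, u)"
      using ht Suc by (intro cycle_pos_eqI s) (auto simp: m_def)
    \<comment> \<open>Here t < m ensures that the natural-number subtraction in the exponent does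
      not truncate.\<close>
    moreover have "a * a ^ (m - Suc (Suc u)) = a ^ (m - Suc u)"
      using ht(2) Suc by (metis Suc_diff_Suc power_Suc)
    ultimately show ?thesis
      using cp Suc zero by (simp add: rho_def cycle_def pos_def algebra_simps flip: m_def)
  qed
qed

theorem corollary5p3:
  fixes n s1 s2 :: nat and a b :: complex
  assumes "s1 < s2" "s2 < n" "a \<noteq> 0" "b \<noteq> 0"
    and "a ^ reduced n (s2 - s1) - (- b) ^ reduced n (s2 - s1) \<noteq> 0"
  shows "let A = a \<cdot>\<^sub>m (perm_mat n ^\<^sub>m s1) + b \<cdot>\<^sub>m (perm_mat n ^\<^sub>m s2);
             B = (1 / (a ^ reduced n (s2 - s1) - (- b) ^ reduced n (s2 - s1))) \<cdot>\<^sub>m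
               (\<Oplus>\<^bsub>module_mat TYPE(complex) n n\<^esub> i\<in>{0..<n}.
                  rho a b n (s2 - s1) (int (i + s1)) \<cdot>\<^sub>m (perm_mat n ^\<^sub>m i))
         in inverts_mat A B \<and> inverts_mat B A"
proof -
  define s where "s = s2 - s1"
  define D where "D = a ^ reduced n s - (- b) ^ reduced n s"
  \<comment> \<open>The offset s1 is undone by the shift from the s1-th power; the s2-th power then
    leaves a net shift by s.\<close>
  define f where "f = (\<lambda>x. rho a b n s (x + int s1))"
  define A where "A = a \<cdot>\<^sub>m (perm_mat n ^\<^sub>m s1) + b \<cdot>\<^sub>m (perm_mat n ^\<^sub>m s2)"
  define B where "B = (1 / D) \<cdot>\<^sub>m (\<Oplus>\<^bsub>module_mat TYPE(complex) n n\<^esub> i\<in>{0..<n}.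
    rho a b n s (int (i + s1)) \<cdot>\<^sub>m (perm_mat n ^\<^sub>m i))"
  have s: "0 < s" "s < n" "int s = int s2 - int s1" using assms by (auto simp: s_def)
  have D: "D \<noteq> 0" using assms by (simp add: D_def s_def)
  have f: "f x = f y" if "[x = y] (mod int n)" for x y
    unfolding f_def by (rule rho_cong) (intro cong_add that cong_refl)
  have B: "B = (1 / D) \<cdot>\<^sub>m circ n f"
    unfolding B_def using finsum_perm_mat_pow[of n f, OF f] by (simp add: f_def)
  have carrier: "A \<in> carrier_mat n n" "B \<in> carrier_mat n n" by (auto simp: A_def B)
  have "A * B = (1 / D) \<cdot>\<^sub>m (A * circ n f)"
    unfolding B by (rule mult_smult_distrib[OF carrier(1) circ_carrier])
  also have "A * circ n f = a \<cdot>\<^sub>m circ n (\<lambda>x. f (x - int s1)) + b \<cdot>\<^sub>m circ n (\<lambda>x. f (x - int s2))"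
    unfolding A_def
    by (simp add: add_mult_distrib_mat[of _ n n _ _ n] mult_smult_assoc_mat[of _ n n _ n]
        perm_mat_pow_mult_circ[of n f, OF f])
  also have "(1 / D) \<cdot>\<^sub>m \<dots>
      = circ n (\<lambda>x. (a * rho a b n s x + b * rho a b n s (x - int s)) / D)"
    by (rule eq_matI) (auto simp: circ_def f_def s(3) algebra_simps add_divide_distrib)
  \<comment> \<open>By the recurrence the numerator is \<open>D\<close> times the symbol of the
    identity.\<close>
  also have "\<dots> = 1\<^sub>m n"
    unfolding rho_recurrence[OF s(1,2)] one_mat_eq_circ D_def[symmetric] using D
    by (intro arg_cong[of _ _ "circ n"] ext) simp
  finally have AB: "A * B = 1\<^sub>m n" .
  \<comment> \<open>For square matrices over a field a right inverse is also a left inverse, so only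
    one product is computed.\<close>
  moreover from this have "B * A = 1\<^sub>m n"
    by (rule mat_mult_left_right_inverse[OF carrier])
  ultimately have "inverts_mat A B \<and> inverts_mat B A"
    using carrier by (simp add: inverts_mat_def)
  then show ?thesis
    unfolding A_def B_def D_def s_def Let_def .
qed

end
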